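(* Let $N\ge2$ and $s\in(0,1)$. Let $u\in LSC(\mathbb{R}^N_+)\cap\mathcal S$ be a nonnegative viscosity supersolution of $$\mathcal I_N^-u(x)+u^p(x)=0\ \text{ in }\mathbb{R}^N_+,\qquad u=0\ \text{ in }\mathbb{R}^N\setminus\mathbb{R}^N_+ .$$ If $0<p\le1$, then $u(x)\equiv0$ in $\mathbb{R}^N_+$.
   Context: $\mathbb{R}^N_+=\{x=(x',x_N)\in\mathbb{R}^{N-1}\times\mathbb{R}: x_N>0\}$. For a unit vector $\xi\in\mathbb{R}^N$, $$\mathcal I_\xi u(x)=C_s\int_0^{+\infty}\frac{u(x+\tau\xi)+u(x-\tau\xi)-2u(x)}{\tau^{1+2s}}\,d\tau,$$ where $C_s>0$ is a normalizing constant depending only on $s$ (chosen so that $\mathcal I_\xi u(x)\to\langle D^2u(x)\xi,\xi\rangle$ as $s\to1^-$). $\mathcal V_N$ is the set of orthonormal bases $\{\xi_1,\dots,\xi_N\}$ of $\mathbb{R}^N$, and $\mathcal I_N^-u(x)=\inf_{\{\xi_i\}\in\mathcal V_N}\sum_{i=1}^N\mathcal I_{\xi_i}u(x)$. $\mathcal S$ is the space of functions $u:\mathbb{R}^N\to\mathbb{R}$ such that (i) for every $x\in\mathbb{R}^N_+$ and unit vector $\xi$, the map $\tau\in\mathbb{R}\mapsto u(x+\tau\xi)$ is measurable; (ii) there are $\alpha\in[0,2s)$ and $C>0$ with $|u(x)|\le C(1+|x|)^\alpha$ for all $x\in\mathbb{R}^N$. $LSC(\mathbb{R}^N_+)$ means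 lower semicontinuous on $\mathbb{R}^N_+$. Viscosity supersolution: $u\in\mathcal S\cap LSC(\mathbb{R}^N_+)$ is a viscosity supersolution of $\mathcal I u+f(x,u)=0$ in $\mathbb{R}^N_+$ if for every $x_0\in\mathbb{R}^N_+$, $r>0$ with $B_r(x_0)\subseteq\mathbb{R}^N_+$ and $\varphi\in C^2(\overline{B_r(x_0)})$ with $\varphi(x_0)=u(x_0)$ and $\varphi\le u$ in $B_r(x_0)$, the function $\psi$ equal to $\varphi$ in $B_r(x_0)$ and to $u$ in $\mathbb{R}^N\setminus B_r(x_0)$ satisfies $\mathcal I\psi(x_0)+f(x_0,u(x_0))\le 0$. It is a supersolution of the problem with condition $u=0$ in $\mathbb{R}^N\setminus\mathbb{R}^N_+$ if this holds (with $f(x,u)=u^p$) and $u\ge0$ in $\mathbb{R}^N\setminus\mathbb{R}^N_+$. "Nonnegative" means $u\geq 0$ in $\mathbb{R}^N$. *)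

theory Defs
  imports "HOL-Analysis.Analysis"
begin

definition half_space :: "'n::finite \<Rightarrow> (real ^ 'n) set" where
  "half_space k = {x. 0 < x $ k}"

text \<open>
  \<open>f\<close> is in \<open>C\<^sup>2\<close> of the closure of the open set \<open>U\<close>: it is twice continuously
  differentiable in \<open>U\<close>, and \<open>f\<close> and its derivatives of order one and two extend continuously
  to the closure. \<open>G\<close> and \<open>H\<close> are the (extended) gradient and Hessian matrix.
\<close>

definition C2_closure_with ::
  "(real ^ 'n) set \<Rightarrow> (real ^ 'n \<Rightarrow> real) \<Rightarrow> (real ^ 'n \<Rightarrow> real ^ 'n) \<Rightarrow>
   (real ^ 'n \<Rightarrow> real ^ 'n ^ 'n) \<Rightarrow> bool" where
  "C2_closure_with U f G H \<longleftrightarrow>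
     continuous_on (closure U) f \<and> continuous_on (closure U) G \<and> continuous_on (closure U) H \<and>
     (\<forall>x\<in>U. (f has_derivative (\<lambda>h. G x \<bullet> h)) (at x) \<and>
            (G has_derivative (\<lambda>h. H x *v h)) (at x))"

definition C2_closure :: "(real ^ 'n) set \<Rightarrow> (real ^ 'n \<Rightarrow> real) \<Rightarrow> bool" where
  "C2_closure U f \<longleftrightarrow> (\<exists>G H. C2_closure_with U f G H)"

definition lsc_on :: "'a::topological_space set \<Rightarrow> ('a \<Rightarrow> real) \<Rightarrow> bool" where
  "lsc_on \<Omega> u \<longleftrightarrow> (\<forall>x\<in>\<Omega>. \<forall>a < u x. \<forall>\<^sub>F y in at x within \<Omega>. a < u y)"

definition space_S :: "real \<Rightarrow> (real ^ 'n) set \<Rightarrow> (real ^ 'n \<Rightarrow> real) set" where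
  "space_S s \<Omega> = {u.
     (\<forall>x\<in>\<Omega>. \<forall>\<xi>. norm \<xi> = 1 \<longrightarrow>
        (\<lambda>\<tau>::real. u (x + \<tau> *\<^sub>R \<xi>)) \<in> borel_measurable lebesgue) \<and>
     (\<exists>\<alpha> C. 0 \<le> \<alpha> \<and> \<alpha> < 2 * s \<and> 0 < C \<and> (\<forall>x. \<bar>u x\<bar> \<le> C * (1 + norm x) powr \<alpha>))}"

text \<open>
  The integral is a Lebesgue integral, which is absolutely convergent for all the functions
  \<open>\<psi>\<close> of the definition of viscosity supersolutions below.
  The constant is given as a function \<open>C\<close> of \<open>s\<close>.
\<close>

definition directional_op ::
  "(real \<Rightarrow> real) \<Rightarrow> real \<Rightarrow> real ^ 'n \<Rightarrow> (real ^ 'n \<Rightarrow> real) \<Rightarrow> real ^ 'n \<Rightarrow> real" where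
  "directional_op C s \<xi> u x =
     C s * (LINT \<tau>:{0<..}|lebesgue.
       (u (x + \<tau> *\<^sub>R \<xi>) + u (x - \<tau> *\<^sub>R \<xi>) - 2 * u x) / \<tau> powr (1 + 2 * s))"

text \<open>
  Normalization of the constant, for dimension \<open>CARD('n)\<close>: it is positive, and the operator tends
  to the second directional derivative as \<open>s \<rightarrow> 1\<close> from the left, for bounded \<open>C\<^sup>2\<close> functions.
\<close>

definition normalizing_constant :: "'n::finite itself \<Rightarrow> (real \<Rightarrow> real) \<Rightarrow> bool" where
  "normalizing_constant _ C \<longleftrightarrow>
     (\<forall>s. 0 < s \<and> s < 1 \<longrightarrow> 0 < C s) \<and>
     (\<forall>(u :: real ^ 'n \<Rightarrow> real) G H x \<xi>.
        C2_closure_with UNIV u G H \<and> bounded (range u) \<and> norm \<xi> = 1 \<longrightarrow>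
        ((\<lambda>s. directional_op C s \<xi> u x) \<longlongrightarrow> (H x *v \<xi>) \<bullet> \<xi>) (at_left 1))"

definition orthonormal_bases :: "(real ^ 'n) set set" where
  "orthonormal_bases = {B. pairwise orthogonal B \<and> (\<forall>\<xi>\<in>B. norm \<xi> = 1) \<and> span B = UNIV}"

text \<open>
  A real infimum is adequate: for the functions \<open>\<psi>\<close> to which the operator is applied below, the
  growth condition and the \<open>C\<^sup>2\<close> regularity near the point bound the sums uniformly in \<open>B\<close>.
\<close>

definition I_minus ::
  "(real \<Rightarrow> real) \<Rightarrow> real \<Rightarrow> (real ^ 'n \<Rightarrow> real) \<Rightarrow> real ^ 'n \<Rightarrow> real" where
  "I_minus C s u x = (INF B\<in>orthonormal_bases. \<Sum>\<xi>\<in>B. directional_op C s \<xi> u x)"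

text \<open>Viscosity supersolutions of \<open>\<I> u + f (x, u) = 0\<close> in \<open>\<Omega>\<close>.\<close>

definition viscosity_supersolution ::
  "real \<Rightarrow> (real ^ 'n) set \<Rightarrow> ((real ^ 'n \<Rightarrow> real) \<Rightarrow> real ^ 'n \<Rightarrow> real) \<Rightarrow>
   (real ^ 'n \<Rightarrow> real \<Rightarrow> real) \<Rightarrow> (real ^ 'n \<Rightarrow> real) \<Rightarrow> bool" where
  "viscosity_supersolution s \<Omega> \<I> f u \<longleftrightarrow>
     u \<in> space_S s \<Omega> \<and> lsc_on \<Omega> u \<and>
     (\<forall>x0\<in>\<Omega>. \<forall>r>0. \<forall>\<phi>.
        ball x0 r \<subseteq> \<Omega> \<and> C2_closure (ball x0 r) \<phi> \<and>
        \<phi> x0 = u x0 \<and> (\<forall>x\<in>ball x0 r. \<phi> x \<le> u x) \<longrightarrow>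
        \<I> (\<lambda>x. if x \<in> ball x0 r then \<phi> x else u x) x0 + f x0 (u x0) \<le> 0)"

text \<open>The same, for the problem with exterior condition \<open>u = 0\<close> outside \<open>\<Omega>\<close>.\<close>

definition viscosity_supersolution_exterior ::
  "real \<Rightarrow> (real ^ 'n) set \<Rightarrow> ((real ^ 'n \<Rightarrow> real) \<Rightarrow> real ^ 'n \<Rightarrow> real) \<Rightarrow>
   (real ^ 'n \<Rightarrow> real \<Rightarrow> real) \<Rightarrow> (real ^ 'n \<Rightarrow> real) \<Rightarrow> bool" where
  "viscosity_supersolution_exterior s \<Omega> \<I> f u \<longleftrightarrow>
     viscosity_supersolution s \<Omega> \<I> f u \<and> (\<forall>x. x \<notin> \<Omega> \<longrightarrow> 0 \<le> u x)"

end

theory Submission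
  imports Defs
begin

text \<open>
  The truncated paraboloid \<open>\<phi> = max 0 (R\<^sup>2 - \<bar>x - y\<bar>\<^sup>2)\<close> is used as a barrier. With \<open>q = \<phi> x\<close>, the
  fractional second derivative of \<open>\<phi>\<close> in a direction \<open>\<xi>\<close> is at least \<open>- c q powr (1 - s)\<close>, and it
  gains \<open>\<bar>\<beta>\<bar> powr (2 - 2 s) / 4\<close>, up to the factor \<open>C s\<close>, when \<open>\<beta> = (x - y) \<bullet> \<xi>\<close> satisfies
  \<open>q \<le> \<beta>\<^sup>2 / 4\<close>. Every orthonormal basis contains a direction with a large \<open>\<beta>\<close>, so \<open>\<phi>\<close> is a strict
  subsolution for \<open>I_minus\<close> in an annulus \<open>\<theta> R < \<bar>x - y\<bar> < R\<close>, with \<open>\<theta>\<close> independent of \<open>R\<close>. Hence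
  \<open>t \<phi> \<le> u\<close> spreads from the ball of radius \<open>\<theta> R\<close> to that of radius \<open>R\<close>. This gives the strong
  minimum principle: \<open>u\<close> is positive in the whole half space if it is positive somewhere.
  In that case, take the largest \<open>t\<close> with \<open>t \<phi> \<le> u\<close> for a ball of radius \<open>R\<close> in the half space
  centred at distance \<open>R + 1\<close> from the boundary. At a contact point the equation gives
  \<open>u powr p \<le> c R powr (- 2 s) u\<close>, that is \<open>R powr (2 s) \<le> c (u y) powr (1 - p)\<close>. As \<open>p \<le> 1\<close>, this
  contradicts the growth \<open>\<bar>u x\<bar> \<le> A (1 + \<bar>x\<bar>) powr \<alpha>\<close> with \<open>\<alpha> < 2 s\<close> for large \<open>R\<close>.
\<close>

subsection \<open>Fractional second differences on the line\<close>

lemma set_integrable_lebesgue_greaterThan: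
  fixes f :: "real \<Rightarrow> real"
  assumes "set_integrable lebesgue {a..} f"
  shows "set_integrable lebesgue {a<..} f"
  by (rule set_integrable_subset[OF assms]) auto

text \<open>The terms of the minimum meet at \<open>sqrt q\<close>. Below, the integrand is
  \<open>\<tau> powr (1 - 2 * s)\<close>, integrable at the origin as \<open>s < 1\<close>; above,
  it is \<open>q * \<tau> powr (- (1 + 2 * s))\<close>, integrable at infinity as
  \<open>s > 0\<close>. The pieces add up by
  \<open>1 / (2 - 2 * s) + 1 / (2 * s) = 1 / (2 * s * (1 - s))\<close>.\<close>

lemma has_integral_truncated_square_kernel:
  fixes s q :: real
  assumes s: "0 < s" "s < 1" and q: "0 < q"
  shows "((\<lambda>\<tau>. min (\<tau>\<^sup>2) q / \<tau> powr (1 + 2 * s)) has_integral q powr (1 - s) / (2 * s * (1 - s))) {0..}"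
proof -
  define a where "a = sqrt q"
  have a: "0 < a" "a\<^sup>2 = q" using q by (auto simp: a_def)
  have ap: "a powr (2 * c) = q powr c" for c
    using a by (metis less_eq_real_def numeral_One one_add_one powr_add powr_mult_base powr_powr powr_realpow powr_numeral)
  have "((\<lambda>\<tau>. \<tau> powr (1 - 2 * s)) has_integral (a powr (1 - 2 * s + 1) / (1 - 2 * s + 1))) {0..a}"
    by (rule has_integral_powr_from_0) (use s a in auto)
  moreover have "min (\<tau>\<^sup>2) q / \<tau> powr (1 + 2 * s) = \<tau> powr (1 - 2 * s)" if "\<tau> \<in> {0..a}" for \<tau>
  proof -
    have "\<tau>\<^sup>2 \<le> q" using that a by (metis atLeastAtMost_iff power_mono)
    moreover have "\<tau>\<^sup>2 / \<tau> powr (1 + 2 * s) = \<tau> powr (2 - (1 + 2 * s))" if "0 < \<tau>"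
      using that by (subst powr_diff) (auto simp: powr_numeral)
    ultimately show ?thesis using that by (cases "\<tau> = 0") (auto simp: min_def)
  qed
  ultimately have 1: "((\<lambda>\<tau>. min (\<tau>\<^sup>2) q / \<tau> powr (1 + 2 * s)) has_integral (a powr (1 - 2 * s + 1) / (1 - 2 * s + 1))) {0..a}"
    by (metis (no_types, lifting) has_integral_cong)
  have "((\<lambda>\<tau>. \<tau> powr (- (1 + 2 * s))) has_integral (- (a powr (- (1 + 2 * s) + 1)) / (- (1 + 2 * s) + 1))) {a..}"
    by (rule has_integral_powr_to_inf) (use s a in auto)
  from has_integral_mult_right[OF this, of q]
  have 2: "((\<lambda>\<tau>. min (\<tau>\<^sup>2) q / \<tau> powr (1 + 2 * s)) has_integral (q * (- (a powr (- (1 + 2 * s) + 1)) / (- (1 + 2 * s) + 1)))) {a..}"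
  proof (rule has_integral_eq[rotated])
    fix \<tau> assume "\<tau> \<in> {a..}"
    then have "q \<le> \<tau>\<^sup>2" using a by (metis atLeast_iff less_eq_real_def power_mono)
    then show "q * \<tau> powr (- (1 + 2 * s)) = min (\<tau>\<^sup>2) q / \<tau> powr (1 + 2 * s)"
      by (simp only: powr_minus divide_inverse min_absorb2)
  qed
  have "negligible ({0..a} \<inter> {a..})"
    by (rule negligible_subset[of "{a}"]) auto
  moreover have "{0..a} \<union> {a..} = {0..}" using a by auto
  ultimately
  have "((\<lambda>\<tau>. min (\<tau>\<^sup>2) q / \<tau> powr (1 + 2 * s)) has_integral
     (a powr (1 - 2 * s + 1) / (1 - 2 * s + 1)) + (q * (- (a powr (- (1 + 2 * s) + 1)) / (- (1 + 2 * s) + 1)))) {0..}"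
    using has_integral_Un[OF 1 2] by simp
  moreover have "a powr (1 - 2 * s + 1) = q powr (1 - s)" using ap[of "1 - s"] by (simp add: algebra_simps)
  moreover have "q * a powr (- (1 + 2 * s) + 1) = q powr (1 - s)"
    using ap[of "- s"] powr_mult_base[of q "-s"] q by (simp add: algebra_simps)
  moreover have "Q / (1 - 2 * s + 1) + - Q / (- (1 + 2 * s) + 1) = Q / (2 * s * (1 - s))" for Q :: real
    using s by (simp add: divide_simps) (simp add: algebra_simps)
  ultimately show ?thesis by (metis (no_types, lifting) mult_minus_right times_divide_eq_right)
qed

lemma set_integrable_truncated_square_kernel:
  fixes s q :: real
  assumes "0 < s" "s < 1" "0 < q"
  shows "set_integrable lebesgue {0<..} (\<lambda>\<tau>. min (\<tau>\<^sup>2) q / \<tau> powr (1 + 2 * s))"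
    and "(LINT \<tau>:{0<..}|lebesgue. min (\<tau>\<^sup>2) q / \<tau> powr (1 + 2 * s)) = q powr (1 - s) / (2 * s * (1 - s))"
proof -
  note hi = has_integral_truncated_square_kernel[OF assms]
  show si: "set_integrable lebesgue {0<..} (\<lambda>\<tau>. min (\<tau>\<^sup>2) q / \<tau> powr (1 + 2 * s))"
    using assms
    by (intro set_integrable_lebesgue_greaterThan nonnegative_absolutely_integrable_1
        has_integral_integrable[OF hi]) auto
  have "((\<lambda>\<tau>. min (\<tau>\<^sup>2) q / \<tau> powr (1 + 2 * s)) has_integral q powr (1 - s) / (2 * s * (1 - s))) {0<..}"
    by (rule has_integral_spike_set_eq[THEN iffD1, OF _ _ hi]) (auto intro: negligible_subset[of "{0}"])
  then show "(LINT \<tau>:{0<..}|lebesgue. min (\<tau>\<^sup>2) q / \<tau> powr (1 + 2 * s)) = q powr (1 - s) / (2 * s * (1 - s))"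
    using set_lebesgue_integral_eq_integral(2)[OF si] by (simp add: integral_unique)
qed

text \<open>Quadratic decay at the origin tames the singular kernel because \<open>s < 1\<close>,
  and growth of order \<open>\<alpha> < 2 * s\<close> is absorbed by its decay at infinity.\<close>

lemma set_integrable_second_difference:
  fixes D :: "real \<Rightarrow> real"
  assumes D: "D \<in> borel_measurable lebesgue" and r: "0 < r"
    and near: "\<And>\<tau>. 0 < \<tau> \<Longrightarrow> \<tau> < r \<Longrightarrow> \<bar>D \<tau>\<bar> \<le> K1 * \<tau>\<^sup>2"
    and far: "\<And>\<tau>. r \<le> \<tau> \<Longrightarrow> \<bar>D \<tau>\<bar> \<le> K2 * \<tau> powr \<alpha>"
    and s: "\<alpha> < 2 * s" "s < 1"
  shows "set_integrable lebesgue {0<..} (\<lambda>\<tau>. D \<tau> / \<tau> powr (1 + 2 * s))"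
proof -
  have "(\<lambda>\<tau>::real. \<tau> powr (1 + 2 * s)) \<in> borel_measurable lebesgue"
    by (rule measurable_completion) simp
  then have [measurable]: "(\<lambda>\<tau>. D \<tau> / \<tau> powr (1 + 2 * s)) \<in> borel_measurable lebesgue"
    by (intro borel_measurable_divide D)
  have meas: "set_borel_measurable lebesgue A (\<lambda>\<tau>. D \<tau> / \<tau> powr (1 + 2 * s))" if "A \<in> sets lebesgue" for A
    unfolding set_borel_measurable_def using that by measurable
  have "set_integrable lebesgue {0..r} (\<lambda>\<tau>. \<tau> powr (1 - 2 * s))"
    by (intro nonnegative_absolutely_integrable_1 has_integral_integrable[OF has_integral_powr_from_0])
      (use s r in auto)
  then have "set_integrable lebesgue {0<..<r} (\<lambda>\<tau>. \<tau> powr (1 - 2 * s))"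
    by (rule set_integrable_subset) auto
  then have "set_integrable lebesgue {0<..<r} (\<lambda>\<tau>. K1 * \<tau> powr (1 - 2 * s))"
    by (rule set_integrable_mult_right)
  then have A: "set_integrable lebesgue {0<..<r} (\<lambda>\<tau>. D \<tau> / \<tau> powr (1 + 2 * s))"
  proof (rule set_integrable_bound)
    show "AE \<tau> in lebesgue. \<tau> \<in> {0<..<r} \<longrightarrow>
       norm (D \<tau> / \<tau> powr (1 + 2 * s)) \<le> norm (K1 * \<tau> powr (1 - 2 * s))"
    proof (intro AE_I2 impI)
      fix \<tau> :: real assume \<tau>: "\<tau> \<in> {0<..<r}"
      have "\<tau>\<^sup>2 / \<tau> powr (1 + 2 * s) = \<tau> powr (2 - (1 + 2 * s))"
        using \<tau> by (subst powr_diff) (auto simp: powr_numeral)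
      moreover have "\<bar>D \<tau>\<bar> / \<tau> powr (1 + 2 * s) \<le> K1 * \<tau>\<^sup>2 / \<tau> powr (1 + 2 * s)"
        using near[of \<tau>] \<tau> by (intro divide_right_mono) auto
      ultimately have "\<bar>D \<tau>\<bar> / \<tau> powr (1 + 2 * s) \<le> K1 * \<tau> powr (1 - 2 * s)"
        by (simp add: times_divide_eq_right[symmetric] del: times_divide_eq_right)
      then show "norm (D \<tau> / \<tau> powr (1 + 2 * s)) \<le> norm (K1 * \<tau> powr (1 - 2 * s))" by simp
    qed
  qed (rule meas, simp)
  have "set_integrable lebesgue {r..} (\<lambda>\<tau>. \<tau> powr (\<alpha> - (1 + 2 * s)))"
    by (intro nonnegative_absolutely_integrable_1 has_integral_integrable[OF has_integral_powr_to_inf])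
      (use s r in auto)
  then have "set_integrable lebesgue {r..} (\<lambda>\<tau>. K2 * \<tau> powr (\<alpha> - (1 + 2 * s)))"
    by (rule set_integrable_mult_right)
  then have B: "set_integrable lebesgue {r..} (\<lambda>\<tau>. D \<tau> / \<tau> powr (1 + 2 * s))"
  proof (rule set_integrable_bound)
    show "AE \<tau> in lebesgue. \<tau> \<in> {r..} \<longrightarrow>
       norm (D \<tau> / \<tau> powr (1 + 2 * s)) \<le> norm (K2 * \<tau> powr (\<alpha> - (1 + 2 * s)))"
    proof (intro AE_I2 impI)
      fix \<tau> :: real assume \<tau>: "\<tau> \<in> {r..}"
      have "\<bar>D \<tau>\<bar> / \<tau> powr (1 + 2 * s) \<le> K2 * \<tau> powr \<alpha> / \<tau> powr (1 + 2 * s)"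
        using far[of \<tau>] \<tau> by (intro divide_right_mono) auto
      also have "\<dots> = K2 * \<tau> powr (\<alpha> - (1 + 2 * s))"
        by (simp only: powr_diff times_divide_eq_right)
      finally show "norm (D \<tau> / \<tau> powr (1 + 2 * s)) \<le> norm (K2 * \<tau> powr (\<alpha> - (1 + 2 * s)))" by simp
    qed
  qed (rule meas, simp)
  have "set_integrable lebesgue ({0<..<r} \<union> {r..}) (\<lambda>\<tau>. D \<tau> / \<tau> powr (1 + 2 * s))"
    by (rule set_integrable_Un[OF A B]) auto
  then show ?thesis using r by (simp add: ivl_disj_un)
qed

text \<open>The gain on \<open>{b/2..b}\<close> contributes at least
  \<open>b\<^sup>2 / 2 * b powr (- (1 + 2 * s)) * (b / 2)\<close>, and the loss is twice the
  truncated square integral. Integrability has to be assumed since the Lebesgue integral of a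
  non-integrable function is \<open>0\<close> by default.\<close>

lemma directional_op_ge:
  fixes f :: "real ^ 'n::finite \<Rightarrow> real"
  assumes s: "0 < s" "s < 1" and q: "0 < q" and C: "0 < C s" and t: "0 < t" and b: "0 \<le> b"
    and int: "set_integrable lebesgue {0<..}
      (\<lambda>\<tau>. (f (x + \<tau> *\<^sub>R \<xi>) + f (x - \<tau> *\<^sub>R \<xi>) - 2 * f x) / \<tau> powr (1 + 2 * s))"
    and D: "\<And>\<tau>. 0 < \<tau> \<Longrightarrow> t * (b\<^sup>2 / 2 * indicator {b/2..b} \<tau> - 2 * min (\<tau>\<^sup>2) q)
      \<le> f (x + \<tau> *\<^sub>R \<xi>) + f (x - \<tau> *\<^sub>R \<xi>) - 2 * f x"
  shows "C s * t * (b powr (2 - 2 * s) / 4 - q powr (1 - s) / (s * (1 - s))) \<le> directional_op C s \<xi> f x"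
proof -
  \<comment> \<open>The kernel is frozen at \<open>\<tau> = b\<close>, where it is smallest on
    \<open>{b/2..b}\<close>.\<close>
  define w where "w = b\<^sup>2 / 2 * b powr (- (1 + 2 * s))"
  define m where "m = (\<lambda>\<tau>::real. min (\<tau>\<^sup>2) q / \<tau> powr (1 + 2 * s))"
  note mint = set_integrable_truncated_square_kernel[OF s q, folded m_def]
  have fin: "emeasure lebesgue ({0<..} \<inter> {b/2..b}) < \<infinity>"
  proof -
    have "emeasure lebesgue ({0<..} \<inter> {b/2..b}) \<le> emeasure lebesgue {b/2..b}"
      by (rule emeasure_mono) auto
    then show ?thesis using b by (auto simp: order_le_less_trans)
  qed
  have wint: "set_integrable lebesgue {0<..} (\<lambda>\<tau>. w * indicator {b/2..b} \<tau>)"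
    using fin unfolding set_integrable_def
    by (auto simp: indicator_inter_arith[symmetric] mult.left_commute)
  have wval: "(LINT \<tau>:{0<..}|lebesgue. w * indicator {b/2..b} \<tau>) = b powr (2 - 2 * s) / 4"
  \<comment> \<open>For \<open>b = 0\<close> both sides vanish: \<open>w\<close> is
    \<open>0\<close>, and so is \<open>0 powr (2 - 2 * s)\<close>.\<close>
  proof (cases "b = 0")
    case False
    then have b: "0 < b" using b by simp
    have "{0<..} \<inter> {b/2..b} = {b/2..b}" using b by auto
    then have "(LINT \<tau>:{0<..}|lebesgue. w * indicator {b/2..b} \<tau>) = w * (b / 2)"
      using b by (simp add: set_lebesgue_integral_def indicator_inter_arith[symmetric] mult.left_commute)
    moreover have "b powr (2 - 2 * s) = b powr (3 + - (1 + 2 * s))" by (simp add: algebra_simps)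
    then have "b powr (2 - 2 * s) = b ^ 3 * b powr (- (1 + 2 * s))"
      using b by (simp only: powr_add) (simp add: powr_numeral)
    ultimately show ?thesis by (simp add: w_def power2_eq_square power3_eq_cube)
  qed (simp add: w_def)
  have "t * (b powr (2 - 2 * s) / 4 - q powr (1 - s) / (s * (1 - s)))
      = (LINT \<tau>:{0<..}|lebesgue. t * (w * indicator {b/2..b} \<tau> - 2 * m \<tau>))"
  proof -
    have "q powr (1 - s) / (s * (1 - s)) = 2 * (LINT \<tau>:{0<..}|lebesgue. m \<tau>)"
      unfolding mint(2) by simp
    moreover have "(LINT \<tau>:{0<..}|lebesgue. w * indicator {b/2..b} \<tau> - 2 * m \<tau>) =
        (LINT \<tau>:{0<..}|lebesgue. w * indicator {b/2..b} \<tau>) - (LINT \<tau>:{0<..}|lebesgue. 2 * m \<tau>)"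
      using mint(1) by (intro set_integral_diff(2) wint set_integrable_mult_right) auto
    ultimately show ?thesis
      unfolding set_integral_mult_right wval using wval by simp
  qed
  also have "\<dots> \<le> (LINT \<tau>:{0<..}|lebesgue.
       (f (x + \<tau> *\<^sub>R \<xi>) + f (x - \<tau> *\<^sub>R \<xi>) - 2 * f x) / \<tau> powr (1 + 2 * s))"
  proof (rule set_integral_mono[OF _ int])
    show "set_integrable lebesgue {0<..} (\<lambda>\<tau>. t * (w * indicator {b/2..b} \<tau> - 2 * m \<tau>))"
      using wint mint by (intro set_integrable_mult_right set_integral_diff(1)) auto
    fix \<tau> :: real assume "\<tau> \<in> {0<..}"
    then have \<tau>: "0 < \<tau>" by simp
    have "w \<le> b\<^sup>2 / 2 / \<tau> powr (1 + 2 * s)" if "\<tau> \<le> b"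
    proof -
      have "b powr (- (1 + 2 * s)) \<le> \<tau> powr (- (1 + 2 * s))"
        using \<tau> that s by (intro powr_mono2') auto
      then show ?thesis
        unfolding w_def divide_inverse powr_minus by (intro mult_left_mono) auto
    qed
    then have "w * indicator {b/2..b} \<tau> - 2 * m \<tau>
       \<le> (b\<^sup>2 / 2 * indicator {b/2..b} \<tau> - 2 * min (\<tau>\<^sup>2) q) / \<tau> powr (1 + 2 * s)"
      by (simp add: m_def diff_divide_distrib indicator_def)
    then have "t * (w * indicator {b/2..b} \<tau> - 2 * m \<tau>)
       \<le> t * (b\<^sup>2 / 2 * indicator {b/2..b} \<tau> - 2 * min (\<tau>\<^sup>2) q) / \<tau> powr (1 + 2 * s)"
      using t by (metis mult_left_mono less_imp_le times_divide_eq_right)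
    also have "\<dots> \<le> (f (x + \<tau> *\<^sub>R \<xi>) + f (x - \<tau> *\<^sub>R \<xi>) - 2 * f x) / \<tau> powr (1 + 2 * s)"
      by (intro divide_right_mono D \<tau>) simp
    finally show "t * (w * indicator {b/2..b} \<tau> - 2 * m \<tau>)
       \<le> (f (x + \<tau> *\<^sub>R \<xi>) + f (x - \<tau> *\<^sub>R \<xi>) - 2 * f x) / \<tau> powr (1 + 2 * s)" .
  qed
  finally show ?thesis
    unfolding directional_op_def using C by (simp add: mult.assoc mult_left_mono)
qed

subsection \<open>Minima of lower semicontinuous functions\<close>

lemma lsc_on_subset:
  assumes "lsc_on S f" "T \<subseteq> S"
  shows "lsc_on T f"
  unfolding lsc_on_def
proof (intro ballI allI impI)
  fix x a assume "x \<in> T" "a < f x"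
  then have "\<forall>\<^sub>F y in at x within S. a < f y" using assms by (auto simp: lsc_on_def)
  then show "\<forall>\<^sub>F y in at x within T. a < f y" using at_le[OF assms(2)] by (rule filter_leD[rotated])
qed

lemma lsc_onE:
  assumes "lsc_on S f" "x \<in> S" "a < f x"
  obtains V where "open V" "x \<in> V" "\<And>y. y \<in> V \<Longrightarrow> y \<in> S \<Longrightarrow> a < f y"
proof -
  have "\<forall>\<^sub>F y in at x within S. a < f y" using assms by (auto simp: lsc_on_def)
  then obtain V where "open V" "x \<in> V" "\<forall>y\<in>V. y \<noteq> x \<longrightarrow> y \<in> S \<longrightarrow> a < f y"
    unfolding eventually_at_topological by auto
  then show thesis using assms(3) by (intro that[of V]) auto
qed

text \<open>The inequality \<open>a < (u x - h x) / g x\<close> means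
  \<open>a * g x + h x < u x\<close>; a number strictly between the two sides separates a continuous
  function from a lower semicontinuous one. Used for the difference of \<open>u\<close> and a
  barrier (\<open>g = 1\<close>) and for their quotient (\<open>h = 0\<close>).\<close>

lemma lsc_on_diff_divide:
  assumes u: "lsc_on S u" and h: "continuous_on S h" and g: "continuous_on S g"
    and pos: "\<And>x. x \<in> S \<Longrightarrow> 0 < g x"
  shows "lsc_on S (\<lambda>x. (u x - h x) / g x)"
  unfolding lsc_on_def
proof (intro ballI allI impI)
  fix x a assume x: "x \<in> S" and a: "a < (u x - h x) / g x"
  have "a * g x + h x < u x" using a pos[OF x] by (simp add: field_simps)
  then obtain c where c: "a * g x + h x < c" "c < u x" using dense by blast
  have "continuous_on S (\<lambda>x. a * g x + h x)" by (intro continuous_intros h g)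
  then have "((\<lambda>x. a * g x + h x) \<longlongrightarrow> a * g x + h x) (at x within S)"
    using x by (simp add: continuous_on_def)
  then have "\<forall>\<^sub>F y in at x within S. a * g y + h y < c" using c(1) by (rule order_tendstoD)
  moreover have "\<forall>\<^sub>F y in at x within S. c < u y" using u x c(2) by (auto simp: lsc_on_def)
  moreover have "\<forall>\<^sub>F y in at x within S. y \<in> S" by (simp add: eventually_at_filter)
  ultimately show "\<forall>\<^sub>F y in at x within S. a < (u y - h y) / g y"
  proof eventually_elim
    case (elim y)
    then have "a * g y + h y < u y" by linarith
    then show ?case using pos[of y] elim by (simp add: field_simps)
  qed
qed

text \<open>Without a minimum, each \<open>x\<close> has some \<open>g x\<close> of smaller value,
  and \<open>f\<close> exceeds \<open>f (g x)\<close> near \<open>x\<close>. In a finite subcover,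
  choose \<open>x\<close> with \<open>f (g x)\<close> least: the point \<open>g x\<close> lies in
  some \<open>V z\<close>, whence \<open>f (g z) < f (g x)\<close>, a contradiction.\<close>

lemma lsc_on_attains_inf:
  assumes f: "lsc_on K f" and K: "compact K" "K \<noteq> {}"
  obtains x where "x \<in> K" "\<And>y. y \<in> K \<Longrightarrow> f x \<le> f y"
proof (rule ccontr)
  assume "\<not> thesis"
  then have "\<forall>x\<in>K. \<exists>y\<in>K. f y < f x" using that by (meson not_le)
  then obtain g where g: "\<And>x. x \<in> K \<Longrightarrow> g x \<in> K" "\<And>x. x \<in> K \<Longrightarrow> f (g x) < f x" by metis
  have "\<forall>x\<in>K. \<exists>V. open V \<and> x \<in> V \<and> (\<forall>z\<in>V \<inter> K. f (g x) < f z)"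
    using lsc_onE[OF f] g(2) by (metis IntE)
  then obtain V where V: "\<And>x. x \<in> K \<Longrightarrow> open (V x)" "\<And>x. x \<in> K \<Longrightarrow> x \<in> V x"
    "\<And>x z. x \<in> K \<Longrightarrow> z \<in> V x \<Longrightarrow> z \<in> K \<Longrightarrow> f (g x) < f z"
    by (metis IntI)
  have "K \<subseteq> (\<Union>x\<in>K. V x)" using V(2) by auto
  then obtain D where D: "D \<subseteq> K" "finite D" "K \<subseteq> (\<Union>x\<in>D. V x)"
    using compactE_image[OF K(1), of K V] V(1) by auto
  have "D \<noteq> {}" using D K by auto
  then obtain x where x: "x \<in> D" "\<And>z. z \<in> D \<Longrightarrow> f (g x) \<le> f (g z)"
    using arg_min_if_finite[OF D(2), of "\<lambda>x. f (g x)"] by (metis not_le)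
  then have "g x \<in> K" using g D by auto
  then obtain z where z: "z \<in> D" "g x \<in> V z" using D by auto
  then have "f (g z) < f (g x)" using V(3)[of z "g x"] D \<open>g x \<in> K\<close> by auto
  with x(2)[OF z(1)] show False by simp
qed

subsection \<open>Orthonormal bases and paraboloids\<close>

lemma Basis_in_orthonormal_bases: "Basis \<in> orthonormal_bases"
  by (auto simp: orthonormal_bases_def pairwise_def orthogonal_def inner_Basis)

lemma orthonormal_bases_finite_card:
  fixes B :: "(real ^ 'n::finite) set"
  assumes "B \<in> orthonormal_bases"
  shows "finite B" "card B = CARD('n)"
proof -
  have B: "pairwise orthogonal B" "\<forall>\<xi>\<in>B. norm \<xi> = 1" "span B = UNIV"
    using assms by (auto simp: orthonormal_bases_def)
  then have "0 \<notin> B" by auto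
  then have ind: "independent B" using B pairwise_orthogonal_independent by blast
  then show "finite B" by (rule independent_imp_finite)
  have "card B = dim (UNIV :: (real ^ 'n) set)"
    using basis_card_eq_dim[of B UNIV] B ind by auto
  then show "card B = CARD('n)" by simp
qed

text \<open>By Parseval the squared components sum to \<open>(norm v)\<^sup>2\<close>, so they
  cannot all lie below their average.\<close>

lemma orthonormal_bases_large_component:
  fixes v :: "real ^ 'n::finite"
  assumes B: "B \<in> orthonormal_bases"
  obtains \<xi> where "\<xi> \<in> B" "(norm v)\<^sup>2 / CARD('n) \<le> (v \<bullet> \<xi>)\<^sup>2"
proof (rule ccontr)
  assume "\<not> thesis"
  then have lt: "\<And>\<xi>. \<xi> \<in> B \<Longrightarrow> (v \<bullet> \<xi>)\<^sup>2 < (norm v)\<^sup>2 / CARD('n)"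
    using that by (meson not_le)
  note fc = orthonormal_bases_finite_card[OF B]
  have "(\<Sum>\<xi>\<in>B. (v \<bullet> \<xi>) *\<^sub>R \<xi>) = v"
    using B by (intro orthonormal_basis_expand fc(1)) (auto simp: orthonormal_bases_def)
  then have "v \<bullet> v = (\<Sum>\<xi>\<in>B. (v \<bullet> \<xi>)\<^sup>2)"
    by (metis (no_types, lifting) inner_scaleR_right inner_sum_right power2_eq_square sum.cong)
  also have "\<dots> < (\<Sum>\<xi>\<in>B. (norm v)\<^sup>2 / CARD('n))"
    using fc by (intro sum_strict_mono lt) (auto simp: card_gt_0_iff[symmetric])
  also have "\<dots> = v \<bullet> v" using fc by (simp add: dot_square_norm)
  finally show False by simp
qed

section \<open>Paraboloids and their truncated second differences\<close>

definition paraboloid :: "'a::real_inner \<Rightarrow> real \<Rightarrow> 'a \<Rightarrow> real" where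
  "paraboloid y R x = R\<^sup>2 - (norm (x - y))\<^sup>2"

lemma paraboloid_along:
  assumes "norm \<xi> = 1"
  shows "paraboloid y R (x + \<tau> *\<^sub>R \<xi>) = paraboloid y R x - 2 * \<tau> * ((x - y) \<bullet> \<xi>) - \<tau>\<^sup>2"
proof -
  have "\<xi> \<bullet> \<xi> = 1" using assms by (simp add: dot_square_norm)
  then show ?thesis
    unfolding paraboloid_def power2_norm_eq_inner
    by (simp add: algebra_simps inner_commute power2_eq_square)
qed

lemma paraboloid_gt_0_iff: "0 \<le> R \<Longrightarrow> 0 < paraboloid y R x \<longleftrightarrow> x \<in> ball y R"
  using power2_less_imp_less[of "norm (x - y)" R] power_strict_mono[of "norm (x - y)" R 2]
  by (auto simp: paraboloid_def dist_norm norm_minus_commute)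

lemma continuous_on_paraboloid: "continuous_on S (paraboloid y R)"
  unfolding paraboloid_def by (intro continuous_intros)

text \<open>Makes the untruncated barrier, lowered by a constant \<open>m\<close>, admissible as a
  test function: the gradient is \<open>- 2 * t\<close> times \<open>x - y\<close> and the Hessian
  is \<open>- 2 * t\<close> times the identity.\<close>

lemma C2_closure_paraboloid:
  fixes y :: "real ^ 'n::finite"
  shows "C2_closure U (\<lambda>x. t * paraboloid y R x - m)"
  unfolding C2_closure_def C2_closure_with_def
proof (intro exI conjI ballI)
  show "continuous_on (closure U) (\<lambda>x. t * paraboloid y R x - m)"
    by (intro continuous_intros continuous_on_paraboloid)
  show "continuous_on (closure U) (\<lambda>x. (- 2 * t) *\<^sub>R (x - y))"
    by (intro continuous_intros)
  show "continuous_on (closure U) (\<lambda>x. mat (- 2 * t) :: real ^ 'n ^ 'n)"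
    by (intro continuous_intros)
  fix x
  show "((\<lambda>x. t * paraboloid y R x - m) has_derivative (\<lambda>h. ((- 2 * t) *\<^sub>R (x - y)) \<bullet> h)) (at x)"
  proof (rule has_derivative_eq_rhs)
    show "((\<lambda>x. t * paraboloid y R x - m) has_derivative
        (\<lambda>h. t * (0 - ((x - y) \<bullet> (h - 0) + (h - 0) \<bullet> (x - y))) - 0)) (at x)"
      unfolding paraboloid_def power2_norm_eq_inner by (intro derivative_intros)
  qed (simp add: fun_eq_iff inner_commute[of _ "x - y"])
  have "mat (- 2 * t) *v h = (- 2 * t) *\<^sub>R h" for h :: "real ^ 'n"
    by (simp add: vec_eq_iff matrix_vector_mult_def mat_def if_distrib[of "\<lambda>x. x * _"] cong: if_cong)
  moreover have "((\<lambda>x. (- 2 * t) *\<^sub>R (x - y)) has_derivative (\<lambda>h. (- 2 * t) *\<^sub>R (h - 0))) (at x)"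
    by (intro derivative_intros)
  ultimately show "((\<lambda>x. (- 2 * t) *\<^sub>R (x - y)) has_derivative (*v) (mat (- 2 * t))) (at x)"
    by (simp add: has_derivative_eq_rhs fun_eq_iff)
qed

text \<open>
  For \<open>\<tau>\<close> between half of \<open>reach q \<beta>\<close> and all of it, the second difference of a truncated parabola
  with value \<open>q\<close> and slope \<open>-2 \<beta>\<close> exceeds its worst case by at least half the square of
  \<open>reach q \<beta>\<close>. The value \<open>0\<close> encodes that there is no gain.
\<close>

definition reach :: "real \<Rightarrow> real \<Rightarrow> real" where
  "reach q \<beta> = (if q \<le> \<beta>\<^sup>2 / 4 then \<bar>\<beta>\<bar> else 0)"

lemma reach_nonneg: "0 \<le> reach q \<beta>"
  by (simp add: reach_def)

text \<open>The worst case uses only that the sum of the two maxima is at least \<open>0\<close> and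
  at least \<open>2 * q - 2 * \<tau>\<^sup>2\<close>. If \<open>b = \<bar>\<beta>\<bar>\<close> and
  \<open>\<tau>\<close> is in \<open>{b/2..b}\<close>, then \<open>q \<le> \<tau>\<^sup>2\<close>,
  and the branch that rises has value at least
  \<open>q + \<tau> * \<bar>\<beta>\<bar> \<ge> q + b\<^sup>2 / 2\<close>.\<close>

lemma truncated_parabola_second_difference:
  fixes q \<beta> \<tau> :: real
  assumes "0 < q" "0 < \<tau>"
  defines "b \<equiv> reach q \<beta>"
  shows "b\<^sup>2 / 2 * indicator {b/2..b} \<tau> - 2 * min (\<tau>\<^sup>2) q
    \<le> max 0 (q - 2 * \<tau> * \<beta> - \<tau>\<^sup>2) + max 0 (q + 2 * \<tau> * \<beta> - \<tau>\<^sup>2) - 2 * q"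
proof (cases "\<tau> \<in> {b/2..b} \<and> b \<noteq> 0")
  case True
  then have q: "q \<le> \<beta>\<^sup>2 / 4" and b: "b = \<bar>\<beta>\<bar>" by (auto simp: b_def reach_def split: if_splits)
  have "(b / 2)\<^sup>2 \<le> \<tau>\<^sup>2" using True b by (intro power_mono) auto
  then have "q \<le> \<tau>\<^sup>2" using q b by (simp add: power_divide)
  moreover have "b / 2 * b \<le> \<tau> * \<bar>\<beta>\<bar>" using True b by (intro mult_mono) auto
  moreover have "\<tau>\<^sup>2 \<le> \<tau> * \<bar>\<beta>\<bar>" using True b assms(2) by (simp add: power2_eq_square)
  moreover have "\<tau> * \<bar>\<beta>\<bar> = \<tau> * \<beta> \<or> \<tau> * \<bar>\<beta>\<bar> = - (\<tau> * \<beta>)" by (simp add: abs_if)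
  moreover have "b\<^sup>2 / 2 = b / 2 * b" "2 * \<tau> * \<beta> = 2 * (\<tau> * \<beta>)" by (simp_all add: power2_eq_square)
  ultimately show ?thesis using True assms(1) by auto
next
  case False
  then have "b\<^sup>2 / 2 * indicator {b/2..b} \<tau> = 0" by (auto simp: indicator_def)
  moreover have "- 2 * min (\<tau>\<^sup>2) q \<le> max 0 (q - 2 * \<tau> * \<beta> - \<tau>\<^sup>2) + max 0 (q + 2 * \<tau> * \<beta> - \<tau>\<^sup>2) - 2 * q"
    by linarith
  ultimately show ?thesis by linarith
qed

text \<open>The test function \<open>\<psi>\<close> lies above the truncated barrier
  \<open>t * max 0 (paraboloid y R x) - m\<close> everywhere, by nonnegativity of \<open>u\<close>
  and \<open>m\<close> outside \<open>ball y R\<close>, and equals it at \<open>x0\<close>. Its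
  second difference is therefore at least that of the barrier, in which \<open>m\<close>
  cancels.\<close>

lemma touching_second_difference:
  fixes u :: "real ^ 'n::finite \<Rightarrow> real"
  assumes u: "\<And>x. 0 \<le> u x" and t: "0 < t" and m: "0 \<le> m" and R: "0 < R" and r: "0 < r"
    and x0: "x0 \<in> ball y R"
    and below: "\<And>x. x \<in> ball y R \<Longrightarrow> t * paraboloid y R x - m \<le> u x"
    and \<xi>: "norm \<xi> = 1" and \<tau>: "0 < \<tau>"
  defines "\<psi> \<equiv> \<lambda>x. if x \<in> ball x0 r then t * paraboloid y R x - m else u x"
    and "b \<equiv> reach (paraboloid y R x0) ((x0 - y) \<bullet> \<xi>)"
  assumes sub: "ball x0 r \<subseteq> ball y R"
  shows "t * (b\<^sup>2 / 2 * indicator {b/2..b} \<tau> - 2 * min (\<tau>\<^sup>2) (paraboloid y R x0))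
    \<le> \<psi> (x0 + \<tau> *\<^sub>R \<xi>) + \<psi> (x0 - \<tau> *\<^sub>R \<xi>) - 2 * \<psi> x0"
proof -
  define q \<beta> where "q = paraboloid y R x0" and "\<beta> = (x0 - y) \<bullet> \<xi>"
  have pos: "0 < paraboloid y R x \<longleftrightarrow> x \<in> ball y R" for x using R by (simp add: paraboloid_gt_0_iff)
  have ge: "t * max 0 (paraboloid y R x) - m \<le> \<psi> x" for x
  proof (cases "x \<in> ball y R")
    case True
    then have "max 0 (paraboloid y R x) = paraboloid y R x" using pos[of x] by simp
    then show ?thesis using below[OF True] by (auto simp: \<psi>_def)
  next
    case False
    then have "max 0 (paraboloid y R x) = 0" using pos[of x] by simp
    moreover have "x \<notin> ball x0 r" using False sub by blast
    ultimately show ?thesis using u[of x] m by (auto simp: \<psi>_def)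
  qed
  have "b\<^sup>2 / 2 * indicator {b/2..b} \<tau> - 2 * min (\<tau>\<^sup>2) q
      \<le> max 0 (q - 2 * \<tau> * \<beta> - \<tau>\<^sup>2) + max 0 (q + 2 * \<tau> * \<beta> - \<tau>\<^sup>2) - 2 * q"
    using truncated_parabola_second_difference[of q \<tau> \<beta>] x0 pos \<tau> by (simp add: b_def q_def \<beta>_def)
  then have "t * (b\<^sup>2 / 2 * indicator {b/2..b} \<tau> - 2 * min (\<tau>\<^sup>2) q)
      \<le> t * (max 0 (q - 2 * \<tau> * \<beta> - \<tau>\<^sup>2) + max 0 (q + 2 * \<tau> * \<beta> - \<tau>\<^sup>2) - 2 * q)"
    using t by simp
  also have "\<dots> = (t * max 0 (paraboloid y R (x0 + \<tau> *\<^sub>R \<xi>)) - m)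
      + (t * max 0 (paraboloid y R (x0 - \<tau> *\<^sub>R \<xi>)) - m) - 2 * (t * q - m)"
    using paraboloid_along[OF \<xi>, of y R x0 \<tau>] paraboloid_along[OF \<xi>, of y R x0 "-\<tau>"]
    by (simp add: q_def \<beta>_def right_diff_distrib distrib_left)
  also have "\<dots> \<le> \<psi> (x0 + \<tau> *\<^sub>R \<xi>) + \<psi> (x0 - \<tau> *\<^sub>R \<xi>) - 2 * \<psi> x0"
    using ge[of "x0 + \<tau> *\<^sub>R \<xi>"] ge[of "x0 - \<tau> *\<^sub>R \<xi>"] r by (simp add: \<psi>_def q_def)
  finally show ?thesis by (simp add: q_def)
qed

text \<open>For \<open>\<tau> < r\<close> the second difference is exactly that of a paraboloid,
  \<open>- 2 * t * \<tau>\<^sup>2\<close>; for larger \<open>\<tau>\<close> the growth condition on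
  \<open>u\<close> takes over.\<close>

lemma touching_integrable:
  fixes u :: "real ^ 'n::finite \<Rightarrow> real" and y :: "real ^ 'n" and t m R :: real
  assumes u: "u \<in> space_S s \<Omega>" and x0: "x0 \<in> \<Omega>" and s: "s < 1" and r: "0 < r" and \<xi>: "norm \<xi> = 1"
  defines "\<psi> \<equiv> \<lambda>x. if x \<in> ball x0 r then t * paraboloid y R x - m else u x"
  shows "set_integrable lebesgue {0<..}
    (\<lambda>\<tau>. (\<psi> (x0 + \<tau> *\<^sub>R \<xi>) + \<psi> (x0 - \<tau> *\<^sub>R \<xi>) - 2 * \<psi> x0) / \<tau> powr (1 + 2 * s))"
proof -
  obtain \<alpha> A where A: "0 \<le> \<alpha>" "\<alpha> < 2 * s" "0 < A" "\<And>x. \<bar>u x\<bar> \<le> A * (1 + norm x) powr \<alpha>"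
    using u by (auto simp: space_S_def)
  have in_ball: "x0 + \<tau> *\<^sub>R \<xi> \<in> ball x0 r \<longleftrightarrow> \<bar>\<tau>\<bar> < r" for \<tau>
    using \<xi> by (simp add: dist_norm)
  have line: "(\<lambda>\<tau>. \<psi> (x0 + \<tau> *\<^sub>R \<zeta>)) \<in> borel_measurable lebesgue" if \<zeta>: "norm \<zeta> = 1" for \<zeta>
  proof -
    have "(\<lambda>\<tau>::real. u (x0 + \<tau> *\<^sub>R \<zeta>)) \<in> borel_measurable lebesgue"
      using u x0 \<zeta> by (auto simp: space_S_def)
    moreover have "(\<lambda>\<tau>. t * paraboloid y R (x0 + \<tau> *\<^sub>R \<zeta>) - m) \<in> borel_measurable lebesgue"
      by (rule measurable_completion)
        (auto simp: paraboloid_def intro!: borel_measurable_continuous_onI continuous_intros)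
    moreover have "{\<tau>::real. \<bar>\<tau>\<bar> < r} \<in> sets lebesgue"
      by (intro borel_open open_Collect_less continuous_intros lborelD sets_completionI_sets)
    moreover have "x0 + \<tau> *\<^sub>R \<zeta> \<in> ball x0 r \<longleftrightarrow> \<bar>\<tau>\<bar> < r" for \<tau>
      using \<zeta> by (simp add: dist_norm)
    ultimately show ?thesis
      unfolding \<psi>_def by (intro measurable_If) auto
  qed
  have "(\<lambda>\<tau>. \<psi> (x0 - \<tau> *\<^sub>R \<xi>)) \<in> borel_measurable lebesgue"
    using line[of "-\<xi>"] \<xi> by simp
  then have meas: "(\<lambda>\<tau>. \<psi> (x0 + \<tau> *\<^sub>R \<xi>) + \<psi> (x0 - \<tau> *\<^sub>R \<xi>) - 2 * \<psi> x0) \<in> borel_measurable lebesgue"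
    using line[OF \<xi>] by (intro borel_measurable_add borel_measurable_diff) auto
  \<comment> \<open>For \<open>r \<le> \<tau>\<close>, these constants absorb lower order terms:
    \<open>1 + norm x0 + \<tau> \<le> M * \<tau>\<close> and
    \<open>\<bar>\<psi> x0\<bar> \<le> c * \<tau> powr \<alpha>\<close>.\<close>
  define M where "M = (1 + norm x0) / r + 1"
  define c where "c = \<bar>\<psi> x0\<bar> / r powr \<alpha>"
  have near: "\<bar>\<psi> (x0 + \<tau> *\<^sub>R \<xi>) + \<psi> (x0 - \<tau> *\<^sub>R \<xi>) - 2 * \<psi> x0\<bar> \<le> 2 * \<bar>t\<bar> * \<tau>\<^sup>2"
    if "0 < \<tau>" "\<tau> < r" for \<tau>
  proof -
    have "paraboloid y R (x0 + \<tau> *\<^sub>R \<xi>) + paraboloid y R (x0 - \<tau> *\<^sub>R \<xi>) - 2 * paraboloid y R x0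
        = - (2 * \<tau>\<^sup>2)"
      using paraboloid_along[OF \<xi>, of y R x0 \<tau>] paraboloid_along[OF \<xi>, of y R x0 "-\<tau>"] by simp
    moreover have "\<psi> (x0 + \<tau> *\<^sub>R \<xi>) + \<psi> (x0 - \<tau> *\<^sub>R \<xi>) - 2 * \<psi> x0 =
        t * (paraboloid y R (x0 + \<tau> *\<^sub>R \<xi>) + paraboloid y R (x0 - \<tau> *\<^sub>R \<xi>) - 2 * paraboloid y R x0)"
      using in_ball[of \<tau>] in_ball[of "-\<tau>"] that r by (simp add: \<psi>_def right_diff_distrib distrib_left)
    ultimately have "\<psi> (x0 + \<tau> *\<^sub>R \<xi>) + \<psi> (x0 - \<tau> *\<^sub>R \<xi>) - 2 * \<psi> x0 = t * - (2 * \<tau>\<^sup>2)"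
      by simp
    then show ?thesis by (simp add: abs_mult)
  qed
  have far: "\<bar>\<psi> (x0 + \<tau> *\<^sub>R \<xi>) + \<psi> (x0 - \<tau> *\<^sub>R \<xi>) - 2 * \<psi> x0\<bar>
      \<le> (2 * (A * M powr \<alpha>) + 2 * c) * \<tau> powr \<alpha>" if "r \<le> \<tau>" for \<tau>
  proof -
    have \<tau>: "0 < \<tau>" using r that by simp
    have u_le: "\<bar>u x\<bar> \<le> A * M powr \<alpha> * \<tau> powr \<alpha>" if "norm x \<le> norm x0 + \<tau>" for x
    proof -
      have "1 + norm x0 \<le> (1 + norm x0) / r * \<tau>"
        using mult_left_mono[OF \<open>r \<le> \<tau>\<close>, of "(1 + norm x0) / r"] r by simp
      then have "1 + norm x \<le> M * \<tau>" using that by (simp add: M_def algebra_simps)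
      then have "(1 + norm x) powr \<alpha> \<le> (M * \<tau>) powr \<alpha>" using A by (intro powr_mono2) auto
      also have "\<dots> = M powr \<alpha> * \<tau> powr \<alpha>" using \<tau> r by (intro powr_mult)
      finally show ?thesis using A(4)[of x] A(3) by (smt (verit) mult.assoc mult_left_mono)
    qed
    have n: "norm (x0 + \<tau> *\<^sub>R \<xi>) \<le> norm x0 + \<tau>" "norm (x0 - \<tau> *\<^sub>R \<xi>) \<le> norm x0 + \<tau>"
      using norm_triangle_ineq[of x0 "\<tau> *\<^sub>R \<xi>"] norm_triangle_ineq4[of x0 "\<tau> *\<^sub>R \<xi>"] \<xi> \<tau> by auto
    have "\<psi> (x0 + \<tau> *\<^sub>R \<xi>) = u (x0 + \<tau> *\<^sub>R \<xi>)" "\<psi> (x0 - \<tau> *\<^sub>R \<xi>) = u (x0 - \<tau> *\<^sub>R \<xi>)"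
      using in_ball[of \<tau>] in_ball[of "-\<tau>"] that \<tau> by (simp_all add: \<psi>_def)
    moreover have "\<bar>\<psi> x0\<bar> \<le> c * \<tau> powr \<alpha>"
    proof -
      have "\<bar>\<psi> x0\<bar> = c * r powr \<alpha>" using r by (simp add: c_def)
      also have "\<dots> \<le> c * \<tau> powr \<alpha>"
        using that r A by (intro mult_left_mono powr_mono2) (auto simp: c_def)
      finally show ?thesis .
    qed
    ultimately show ?thesis using u_le[OF n(1)] u_le[OF n(2)] by (simp add: algebra_simps)
  qed
  show ?thesis by (rule set_integrable_second_difference[OF meas r near far A(2) s])
qed

text \<open>Near the sphere of radius \<open>R\<close> the barrier value \<open>q\<close> is small
  compared with \<open>(norm (x - y))\<^sup>2\<close>. A basis vector with large component then has
  full reach, and its gain is at least twice the losses of all directions together. All conditions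
  are scale invariant, so \<open>\<theta>\<close> depends only on \<open>s\<close> and the
  dimension.\<close>

lemma boundary_layer_gain:
  fixes s :: real
  assumes s: "0 < s" "s < 1"
  obtains \<theta> where "0 < \<theta>" "\<theta> < 1"
    and "\<And>y R x B. \<lbrakk>0 < R; \<theta> * R < norm (x - y); norm (x - y) < R;
        B \<in> orthonormal_bases\<rbrakk> \<Longrightarrow>
        (((norm (x - y))\<^sup>2 / CARD('n)) powr (1 - s) / 8) \<le>
        (\<Sum>\<xi>\<in>B. reach (paraboloid y R x) ((x - y) \<bullet> \<xi>) powr (2 - 2 * s) / 4
          - paraboloid y R (x :: real ^ 'n::finite) powr (1 - s) / (s * (1 - s)))"
proof -
  define N where "N = real CARD('n)"
  have N: "0 < N" by (simp add: N_def)
  \<comment> \<open>If \<open>\<delta> powr (1 - s) \<le> A\<close>, the total loss in all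
    \<open>N\<close> directions is at most half the gain of one good direction.\<close>
  define A where "A = (1 / N) powr (1 - s) * (s * (1 - s) / (8 * N))"
  have A: "0 < A" using N s by (simp add: A_def)
  \<comment> \<open>The first bound yields \<open>q \<le> \<beta>\<^sup>2 / 4\<close> in a direction
    with \<open>\<beta>\<^sup>2 \<ge> \<rho>\<^sup>2 / N\<close>, the second controls the
    loss.\<close>
  define \<delta> where "\<delta> = min (1 / (4 * N)) (A powr (1 / (1 - s)))"
  have \<delta>: "0 < \<delta>" "\<delta> \<le> 1 / (4 * N)" "\<delta> powr (1 - s) \<le> A"
  proof -
    show "0 < \<delta>" "\<delta> \<le> 1 / (4 * N)" using A N by (auto simp: \<delta>_def)
    have "\<delta> powr (1 - s) \<le> (A powr (1 / (1 - s))) powr (1 - s)"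
      using \<open>0 < \<delta>\<close> s by (intro powr_mono2) (auto simp: \<delta>_def)
    then show "\<delta> powr (1 - s) \<le> A" using A s by (simp add: powr_powr)
  qed
  \<comment> \<open>Chosen so that \<open>\<theta> * R < \<rho>\<close> becomes
    \<open>R\<^sup>2 < (1 + \<delta>) * \<rho>\<^sup>2\<close>, that is
    \<open>q < \<delta> * \<rho>\<^sup>2\<close>.\<close>
  define \<theta> where "\<theta> = 1 / sqrt (1 + \<delta>)"
  have \<theta>: "0 < \<theta>" "\<theta> < 1" "\<theta>\<^sup>2 * (1 + \<delta>) = 1" using \<delta> by (auto simp: \<theta>_def power_divide)
  show thesis
  proof (rule that[OF \<theta>(1,2)])
    fix y x :: "real ^ 'n" and R :: real and B :: "(real ^ 'n) set"
    assume R: "0 < R" and lo: "\<theta> * R < norm (x - y)" and hi: "norm (x - y) < R"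
      and B: "B \<in> orthonormal_bases"
    define q \<rho> where "q = paraboloid y R x" and "\<rho> = norm (x - y)"
    have \<rho>: "0 < \<rho>" using lo R \<theta> by (metis \<rho>_def mult_pos_pos order_less_trans)
    have q: "0 < q" using hi R by (simp add: q_def paraboloid_gt_0_iff dist_norm norm_minus_commute)
    have "(\<theta> * R)\<^sup>2 < \<rho>\<^sup>2" using lo R \<theta> by (intro power_strict_mono) (auto simp: \<rho>_def)
    then have "(\<theta> * R)\<^sup>2 * (1 + \<delta>) < \<rho>\<^sup>2 * (1 + \<delta>)" using \<delta> by simp
    then have "R\<^sup>2 < \<rho>\<^sup>2 * (1 + \<delta>)"
      using \<theta>(3) by (metis (no_types, lifting) mult.commute mult.left_commute mult_1 power_mult_distrib)
    then have q_le: "q \<le> \<delta> * \<rho>\<^sup>2" by (simp add: q_def paraboloid_def \<rho>_def algebra_simps)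
    note fc = orthonormal_bases_finite_card[OF B]
    obtain \<xi> where \<xi>: "\<xi> \<in> B" "\<rho>\<^sup>2 / N \<le> ((x - y) \<bullet> \<xi>)\<^sup>2"
      using orthonormal_bases_large_component[OF B, of "x - y"] by (auto simp: \<rho>_def N_def)
    have "q \<le> 1 / (4 * N) * \<rho>\<^sup>2" using q_le \<delta>(2) \<rho> by (meson order_trans mult_right_mono zero_le_power2)
    then have "q \<le> ((x - y) \<bullet> \<xi>)\<^sup>2 / 4" using \<xi>(2) by (simp add: field_simps)
    then have reach: "reach q ((x - y) \<bullet> \<xi>) = \<bar>(x - y) \<bullet> \<xi>\<bar>" by (simp add: reach_def)
    have sq: "\<bar>z\<bar> powr (2 - 2 * s) = z\<^sup>2 powr (1 - s)" for z :: real
      using powr_powr[of "\<bar>z\<bar>" 2 "1 - s"] by (simp add: powr_numeral algebra_simps)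
    have gain: "(\<rho>\<^sup>2 / N) powr (1 - s) / 4 \<le> reach q ((x - y) \<bullet> \<xi>) powr (2 - 2 * s) / 4"
      unfolding reach sq using \<xi>(2) N s by (intro divide_right_mono powr_mono2) auto
    also have "\<dots> \<le> (\<Sum>\<xi>\<in>B. reach q ((x - y) \<bullet> \<xi>) powr (2 - 2 * s) / 4)"
      using fc(1) \<xi>(1) by (intro member_le_sum) auto
    finally have 1: "(\<rho>\<^sup>2 / N) powr (1 - s) / 4 \<le> (\<Sum>\<xi>\<in>B. reach q ((x - y) \<bullet> \<xi>) powr (2 - 2 * s) / 4)" .
    have "q powr (1 - s) \<le> (\<delta> * \<rho>\<^sup>2) powr (1 - s)" using q q_le s by (intro powr_mono2) auto
    also have "\<dots> = \<delta> powr (1 - s) * \<rho>\<^sup>2 powr (1 - s)" using \<delta> by (simp add: powr_mult)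
    also have "\<dots> \<le> A * \<rho>\<^sup>2 powr (1 - s)" using \<delta> by (intro mult_right_mono) auto
    also have "\<dots> = (\<rho>\<^sup>2 / N) powr (1 - s) * (s * (1 - s) / (8 * N))"
      using N powr_mult[of "1 / N" "\<rho>\<^sup>2" "1 - s"] by (simp add: A_def)
    finally have "N * (q powr (1 - s) / (s * (1 - s))) \<le> (\<rho>\<^sup>2 / N) powr (1 - s) / 8"
      using N s by (simp add: field_simps)
    then show "(((norm (x - y))\<^sup>2 / CARD('n)) powr (1 - s) / 8) \<le>
        (\<Sum>\<xi>\<in>B. reach (paraboloid y R x) ((x - y) \<bullet> \<xi>) powr (2 - 2 * s) / 4
          - paraboloid y R x powr (1 - s) / (s * (1 - s)))"
      using 1 fc by (simp add: sum_subtractf q_def \<rho>_def N_def)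
  qed
qed

subsection \<open>Supersolutions in the half space\<close>

lemma cball_subset_half_space:
  assumes R: "R < y $ k"
  shows "cball y R \<subseteq> half_space k"
proof
  fix x assume "x \<in> cball y R"
  then have "norm (y - x) \<le> R" by (simp add: dist_norm)
  then have "\<bar>y $ k - x $ k\<bar> \<le> R" using component_le_norm_cart[of "y - x" k] by simp
  then show "x \<in> half_space k" using R by (auto simp: half_space_def)
qed

locale half_space_supersolution =
  fixes k :: "'n::finite" and C :: "real \<Rightarrow> real" and s p :: real and u :: "real ^ 'n \<Rightarrow> real"
  assumes s: "0 < s" "s < 1" and C_pos: "0 < C s" and u_nonneg: "\<And>x. 0 \<le> u x"
    and supersolution: "viscosity_supersolution s (half_space k) (I_minus C s) (\<lambda>x t. t powr p) u"
begin

lemma u_space_S: "u \<in> space_S s (half_space k)"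
  and u_lsc: "lsc_on (half_space k) u"
  using supersolution by (auto simp: viscosity_supersolution_def)

text \<open>Common to both barrier arguments: the lowered paraboloid is inserted into the definition
  of supersolution, and a lower bound \<open>L\<close> valid for every orthonormal basis passes to
  the infimum.\<close>

lemma touching:
  assumes t: "0 < t" and m: "0 \<le> m" and R: "0 < R"
    and ball: "ball y R \<subseteq> half_space k" and x0: "x0 \<in> ball y R"
    and below: "\<And>x. x \<in> ball y R \<Longrightarrow> t * paraboloid y R x - m \<le> u x"
    and touch: "u x0 = t * paraboloid y R x0 - m"
    and L: "\<And>B. B \<in> orthonormal_bases \<Longrightarrow> L \<le>
      (\<Sum>\<xi>\<in>B. reach (paraboloid y R x0) ((x0 - y) \<bullet> \<xi>) powr (2 - 2 * s) / 4
        - paraboloid y R x0 powr (1 - s) / (s * (1 - s)))"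
  shows "C s * t * L + u x0 powr p \<le> 0"
proof -
  obtain r where r: "0 < r" "ball x0 r \<subseteq> ball y R"
    using openE[OF open_ball x0] by blast
  define \<psi> where "\<psi> = (\<lambda>x. if x \<in> ball x0 r then t * paraboloid y R x - m else u x)"
  have q: "0 < paraboloid y R x0" using x0 R by (simp add: paraboloid_gt_0_iff)
  have x0H: "x0 \<in> half_space k" using x0 ball by auto
  have "\<forall>r>0. \<forall>\<phi>. ball x0 r \<subseteq> half_space k \<and> C2_closure (ball x0 r) \<phi> \<and> \<phi> x0 = u x0 \<and>
      (\<forall>x\<in>ball x0 r. \<phi> x \<le> u x) \<longrightarrow>
      I_minus C s (\<lambda>x. if x \<in> ball x0 r then \<phi> x else u x) x0 + u x0 powr p \<le> 0"
    using supersolution x0H unfolding viscosity_supersolution_def by blast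
  then have "I_minus C s \<psi> x0 + u x0 powr p \<le> 0"
    unfolding \<psi>_def
  proof (rule allE[of _ r], elim impE allE[of _ "\<lambda>x. t * paraboloid y R x - m"])
    show "ball x0 r \<subseteq> half_space k \<and> C2_closure (ball x0 r) (\<lambda>x. t * paraboloid y R x - m) \<and>
      t * paraboloid y R x0 - m = u x0 \<and> (\<forall>x\<in>ball x0 r. t * paraboloid y R x - m \<le> u x)"
      using r(2) ball below touch C2_closure_paraboloid by (metis order_trans subsetD)
  qed (rule r(1))
  moreover have "C s * t * L \<le> I_minus C s \<psi> x0"
    unfolding I_minus_def
  \<comment> \<open>For a lower bound on a real infimum, a nonempty index set and a uniform bound
    suffice.\<close>
  proof (rule cINF_greatest)
    show "(orthonormal_bases :: (real ^ 'n) set set) \<noteq> {}" using Basis_in_orthonormal_bases by blast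
    fix B :: "(real ^ 'n) set" assume B: "B \<in> orthonormal_bases"
    have "C s * t * L \<le> C s * t *
      (\<Sum>\<xi>\<in>B. reach (paraboloid y R x0) ((x0 - y) \<bullet> \<xi>) powr (2 - 2 * s) / 4
        - paraboloid y R x0 powr (1 - s) / (s * (1 - s)))"
      using L[OF B] C_pos t by (intro mult_left_mono) auto
    also have "\<dots> \<le> (\<Sum>\<xi>\<in>B. directional_op C s \<xi> \<psi> x0)"
      unfolding sum_distrib_left
    proof (rule sum_mono)
      fix \<xi> assume "\<xi> \<in> B"
      then have \<xi>: "norm \<xi> = 1" using B by (auto simp: orthonormal_bases_def)
      show "C s * t * (reach (paraboloid y R x0) ((x0 - y) \<bullet> \<xi>) powr (2 - 2 * s) / 4
        - paraboloid y R x0 powr (1 - s) / (s * (1 - s))) \<le> directional_op C s \<xi> \<psi> x0"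
      proof (rule directional_op_ge[where C = C, OF s q C_pos t reach_nonneg])
        show "set_integrable lebesgue {0<..}
          (\<lambda>\<tau>. (\<psi> (x0 + \<tau> *\<^sub>R \<xi>) + \<psi> (x0 - \<tau> *\<^sub>R \<xi>) - 2 * \<psi> x0) / \<tau> powr (1 + 2 * s))"
          unfolding \<psi>_def by (rule touching_integrable[OF u_space_S x0H s(2) r(1) \<xi>])
      qed (unfold \<psi>_def, rule touching_second_difference[OF u_nonneg t m R r(1) x0 below \<xi> _ r(2)])
    qed
    finally show "C s * t * L \<le> (\<Sum>\<xi>\<in>B. directional_op C s \<xi> \<psi> x0)" .
  qed
  ultimately show ?thesis by linarith
qed

text \<open>The gains are nonnegative and are dropped; only the worst-case loss, the same in each of
  the \<open>CARD('n)\<close> directions, remains.\<close>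

lemma touching_powr_le:
  assumes "0 < t" "0 < R" "ball y R \<subseteq> half_space k" "x0 \<in> ball y R"
    and "\<And>x. x \<in> ball y R \<Longrightarrow> t * paraboloid y R x \<le> u x"
    and "u x0 = t * paraboloid y R x0"
  shows "u x0 powr p \<le> C s * t * (CARD('n) * (paraboloid y R x0 powr (1 - s) / (s * (1 - s))))"
proof -
  have "C s * t * - (CARD('n) * (paraboloid y R x0 powr (1 - s) / (s * (1 - s)))) + u x0 powr p \<le> 0"
  proof (rule touching[where m = 0])
    fix B :: "(real ^ 'n) set" assume "B \<in> orthonormal_bases"
    then show "- (CARD('n) * (paraboloid y R x0 powr (1 - s) / (s * (1 - s)))) \<le>
      (\<Sum>\<xi>\<in>B. reach (paraboloid y R x0) ((x0 - y) \<bullet> \<xi>) powr (2 - 2 * s) / 4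
        - paraboloid y R x0 powr (1 - s) / (s * (1 - s)))"
      by (simp add: sum_subtractf orthonormal_bases_finite_card sum_nonneg)
  qed (use assms in auto)
  then show ?thesis by simp
qed

text \<open>A negative minimum of \<open>u - t * paraboloid y R\<close> would lie in the open
  annulus: the hypothesis excludes the inner ball, and \<open>u \<ge> 0\<close> excludes the outer
  sphere, where the paraboloid vanishes. There the gain contradicts the equation.\<close>

lemma comparison:
  obtains \<theta> where "0 < \<theta>" "\<theta> < 1"
    and "\<And>y R t. \<lbrakk>0 < R; 0 < t; cball y R \<subseteq> half_space k;
        \<And>x. x \<in> cball y (\<theta> * R) \<Longrightarrow> t * paraboloid y R x \<le> u x\<rbrakk>
      \<Longrightarrow> \<forall>x\<in>cball y R. t * paraboloid y R x \<le> u x"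
proof -
  obtain \<theta> where \<theta>: "0 < \<theta>" "\<theta> < 1"
    and gain: "\<And>y R x B. \<lbrakk>0 < R; \<theta> * R < norm (x - y); norm (x - y) < R;
        B \<in> orthonormal_bases\<rbrakk> \<Longrightarrow>
        (((norm (x - y))\<^sup>2 / CARD('n)) powr (1 - s) / 8) \<le>
        (\<Sum>\<xi>\<in>B. reach (paraboloid y R x) ((x - y) \<bullet> \<xi>) powr (2 - 2 * s) / 4
          - paraboloid y R (x :: real ^ 'n) powr (1 - s) / (s * (1 - s)))"
    by (rule boundary_layer_gain[where 'n='n, OF s]) blast
  show thesis
  proof (rule that[OF \<theta>], rule ccontr)
    fix y R t
    assume R: "0 < R" and t: "0 < t" and sub: "cball y R \<subseteq> half_space k"
      and inner: "\<And>x. x \<in> cball y (\<theta> * R) \<Longrightarrow> t * paraboloid y R x \<le> u x"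
      and "\<not> (\<forall>x\<in>cball y R. t * paraboloid y R x \<le> u x)"
    then obtain z where z: "z \<in> cball y R" "u z < t * paraboloid y R z" by force
    define v where "v = (\<lambda>x. u x - t * paraboloid y R x)"
    have "lsc_on (cball y R) v"
      using lsc_on_diff_divide[OF lsc_on_subset[OF u_lsc sub], of "\<lambda>x. t * paraboloid y R x" "\<lambda>_. 1"]
      by (simp add: v_def continuous_on_mult_left continuous_on_paraboloid)
    then obtain x0 where x0: "x0 \<in> cball y R" "\<And>x. x \<in> cball y R \<Longrightarrow> v x0 \<le> v x"
      using lsc_on_attains_inf[OF _ compact_cball] z(1) by (metis empty_iff)
    have neg: "v x0 < 0" using x0(2)[OF z(1)] z(2) by (simp add: v_def)
    then have "0 < t * paraboloid y R x0" using u_nonneg[of x0] unfolding v_def by linarith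
    then have x0_ball: "x0 \<in> ball y R"
      using t R paraboloid_gt_0_iff[of R y x0] by (simp add: zero_less_mult_iff)
    then have hi: "norm (x0 - y) < R" by (simp add: dist_norm norm_minus_commute)
    have lo: "\<theta> * R < norm (x0 - y)"
      using inner[of x0] neg by (force simp: v_def dist_norm norm_minus_commute)
    \<comment> \<open>Lowering the barrier by \<open>m = - v x0\<close> makes it touch
      \<open>u\<close> from below at \<open>x0\<close>.\<close>
    have "C s * t * (((norm (x0 - y))\<^sup>2 / CARD('n)) powr (1 - s) / 8) + u x0 powr p \<le> 0"
    proof (rule touching[OF t _ R _ x0_ball])
      show "0 \<le> - v x0" "ball y R \<subseteq> half_space k" using neg sub by (auto simp: subset_iff)
      show "t * paraboloid y R x - - v x0 \<le> u x" if "x \<in> ball y R" for x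
        using x0(2)[of x] that by (simp add: v_def)
      show "u x0 = t * paraboloid y R x0 - - v x0" by (simp add: v_def)
    qed (rule gain[OF R lo hi])
    moreover have "0 < norm (x0 - y)" using lo \<theta>(1) R by (meson mult_pos_pos order_less_trans)
    then have "0 < C s * t * (((norm (x0 - y))\<^sup>2 / CARD('n)) powr (1 - s) / 8)"
      using C_pos t by simp
    moreover have "0 \<le> u x0 powr p" by simp
    ultimately show False by linarith
  qed
qed

section \<open>Spreading of positivity\<close>

lemma open_positive: "open {x \<in> half_space k. 0 < u x}"
proof -
  have H: "open (half_space k)" unfolding half_space_def by (rule open_halfspace_component_gt_cart)
  show ?thesis
  proof (subst open_subopen, intro ballI)
    fix x assume x: "x \<in> {x \<in> half_space k. 0 < u x}"
    then obtain V where "open V" "x \<in> V" "\<And>y. y \<in> V \<Longrightarrow> y \<in> half_space k \<Longrightarrow> 0 < u y"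
      using lsc_onE[OF u_lsc, of x 0] by auto
    then show "\<exists>T. open T \<and> x \<in> T \<and> T \<subseteq> {x \<in> half_space k. 0 < u x}"
      using x H by (intro exI[of _ "V \<inter> half_space k"]) auto
  qed
qed

text \<open>The radius of the largest ball about \<open>x0\<close> on which \<open>u\<close> is
  positive cannot be smaller than the distance \<open>x0 $ k\<close> to the boundary, since
  \<open>comparison\<close> would enlarge it by a factor up to \<open>1 / \<theta>\<close>.\<close>

lemma positive_ball:
  assumes x0: "x0 \<in> half_space k" "0 < u x0" and x: "dist x0 x < x0 $ k"
  shows "0 < u x"
proof -
  obtain \<theta> where \<theta>: "0 < \<theta>" "\<theta> < 1"
    and comp: "\<And>y R t. \<lbrakk>0 < R; 0 < t; cball y R \<subseteq> half_space k;
        \<And>x. x \<in> cball y (\<theta> * R) \<Longrightarrow> t * paraboloid y R x \<le> u x\<rbrakk>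
      \<Longrightarrow> \<forall>x\<in>cball y R. t * paraboloid y R x \<le> u x"
    using comparison by blast
  define S where "S = {r. 0 < r \<and> r \<le> x0 $ k \<and> (\<forall>z\<in>ball x0 r. 0 < u z)}"
  have d: "0 < x0 $ k" using x0 by (simp add: half_space_def)
  obtain r0 where r0: "0 < r0" "ball x0 r0 \<subseteq> {x \<in> half_space k. 0 < u x}"
    using open_positive x0 open_contains_ball by (metis (mono_tags, lifting) mem_Collect_eq)
  then have "min r0 (x0 $ k) \<in> S" using d by (auto simp: S_def subset_iff)
  moreover have bdd: "bdd_above S" by (auto simp: S_def bdd_above_def)
  ultimately have "min r0 (x0 $ k) \<le> Sup S" by (intro cSup_upper)
  then have Sup_pos: "0 < Sup S" using r0 d by simp
  have S_ne: "S \<noteq> {}" using \<open>min r0 (x0 $ k) \<in> S\<close> by auto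
  have below_Sup: "0 < u z" if "dist x0 z < Sup S" for z
  proof -
    have "\<exists>r\<in>S. dist x0 z < r" using that unfolding less_cSup_iff[OF S_ne bdd] .
    then show ?thesis by (auto simp: S_def)
  qed
  have "x0 $ k \<le> Sup S"
  proof (rule ccontr)
    assume "\<not> x0 $ k \<le> Sup S"
    \<comment> \<open>\<open>R\<close> is to exceed \<open>Sup S\<close> while
      \<open>\<theta> * R\<close> stays below it, so that positivity is already known on the inner
      ball.\<close>
    moreover have "Sup S < Sup S / \<theta>" using \<theta> Sup_pos by (simp add: field_simps)
    ultimately obtain R where R: "Sup S < R" "R < x0 $ k" "R < Sup S / \<theta>"
      using dense[of "Sup S" "min (x0 $ k) (Sup S / \<theta>)"] by auto
    have R0: "0 < R" using R Sup_pos by linarith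
    have sub: "cball x0 R \<subseteq> half_space k" by (rule cball_subset_half_space) (use R in simp)
    have \<theta>R: "\<theta> * R < Sup S" using R \<theta> by (simp add: field_simps)
    have "\<theta> * R \<le> R" using \<theta> R0 by simp
    then have "lsc_on (cball x0 (\<theta> * R)) u" using lsc_on_subset[OF u_lsc] sub by (meson cball_subset_cball_iff order_trans subset_cball)
    then obtain z where z: "z \<in> cball x0 (\<theta> * R)" "\<And>x. x \<in> cball x0 (\<theta> * R) \<Longrightarrow> u z \<le> u x"
      using lsc_on_attains_inf[OF _ compact_cball] mult_pos_pos[OF \<theta>(1) R0]
      by (metis cball_eq_empty less_asym)
    have uz: "0 < u z" using z(1) \<theta>R by (intro below_Sup) auto
    \<comment> \<open>The factor makes the peak of the barrier equal to the minimum
      \<open>u z\<close> of \<open>u\<close> on the inner ball.\<close>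
    have "\<forall>x\<in>cball x0 R. u z / R\<^sup>2 * paraboloid x0 R x \<le> u x"
    proof (rule comp[OF R0 _ sub])
      show "0 < u z / R\<^sup>2" using uz R0 by simp
      fix x assume x: "x \<in> cball x0 (\<theta> * R)"
      have "u z / R\<^sup>2 * paraboloid x0 R x \<le> u z / R\<^sup>2 * R\<^sup>2"
        using uz by (intro mult_left_mono) (auto simp: paraboloid_def)
      also have "\<dots> = u z" using R0 by simp
      also have "\<dots> \<le> u x" by (rule z(2)[OF x])
      finally show "u z / R\<^sup>2 * paraboloid x0 R x \<le> u x" .
    qed
    moreover have "0 < u z / R\<^sup>2 * paraboloid x0 R x" if "x \<in> ball x0 R" for x
      using that uz R0 paraboloid_gt_0_iff[of R x0 x] by simp
    ultimately have "\<forall>x\<in>ball x0 R. 0 < u x" by (meson ball_subset_cball order_less_le_trans subsetD)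
    then have "R \<in> S" using R R0 by (simp add: S_def)
    then have "R \<le> Sup S" using bdd by (rule cSup_upper)
    with R show False by simp
  qed
  then show ?thesis using x by (intro below_Sup) simp
qed

text \<open>The zero set is open as well, because positivity at a point near a zero would reach that
  zero by \<open>positive_ball\<close>. Connectedness of the half space finishes the
  argument.\<close>

lemma strong_minimum_principle:
  assumes x: "x \<in> half_space k" "0 < u x" and y: "y \<in> half_space k"
  shows "0 < u y"
proof (rule ccontr)
  assume "\<not> 0 < u y"
  then have y0: "u y = 0" using u_nonneg[of y] by simp
  define P Z where "P = {x \<in> half_space k. 0 < u x}" and "Z = {x \<in> half_space k. u x = 0}"
  have "open Z"
    unfolding open_contains_ball
  proof
    fix z assume z: "z \<in> Z"
    then have zk: "0 < z $ k" "u z = 0" by (auto simp: Z_def half_space_def)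
    \<comment> \<open>With half the height of \<open>z\<close> as radius, each \<open>w\<close> in
      the ball satisfies \<open>dist w z < w $ k\<close>, so the ball of positivity around
      \<open>w\<close> would contain \<open>z\<close>.\<close>
    have "ball z (z $ k / 2) \<subseteq> Z"
    proof
      fix w assume "w \<in> ball z (z $ k / 2)"
      then have w: "dist w z < z $ k / 2" by (simp add: dist_commute)
      then have "\<bar>z $ k - w $ k\<bar> < z $ k / 2"
        using component_le_norm_cart[of "z - w" k] by (simp add: dist_norm norm_minus_commute)
      then have wk: "z $ k / 2 < w $ k" by (simp add: abs_if split: if_splits)
      then have wH: "w \<in> half_space k" using zk by (simp add: half_space_def)
      then have "\<not> 0 < u w" using positive_ball[of w z] w wk zk by auto
      then show "w \<in> Z" using wH u_nonneg[of w] by (simp add: Z_def)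
    qed
    then show "\<exists>e>0. ball z e \<subseteq> Z" using zk by (intro exI[of _ "z $ k / 2"]) simp
  qed
  moreover have "connected (half_space k)"
    using convex_connected[OF convex_halfspace_gt[of 0 "axis k (1::real)"]]
    by (simp add: half_space_def inner_axis')
  moreover have "half_space k \<subseteq> P \<union> Z" using u_nonneg by (auto simp: P_def Z_def less_eq_real_def)
  ultimately have "P \<inter> half_space k = {} \<or> Z \<inter> half_space k = {}"
    using open_positive by (intro connectedD) (auto simp: P_def Z_def)
  then show False using x y y0 by (auto simp: P_def Z_def)
qed

text \<open>The contact point is sought in \<open>cball y (\<theta> * R)\<close>: this set is
  compact, the barrier is bounded below there by a multiple of \<open>R\<^sup>2\<close>, and
  \<open>comparison\<close> extends the resulting inequality to the full ball.\<close>

lemma no_positive_point: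
  assumes p: "0 < p" "p \<le> 1" and z: "z \<in> half_space k" "0 < u z"
  shows False
proof -
  obtain \<theta> where \<theta>: "0 < \<theta>" "\<theta> < 1"
    and comp: "\<And>y R t. \<lbrakk>0 < R; 0 < t; cball y R \<subseteq> half_space k;
        \<And>x. x \<in> cball y (\<theta> * R) \<Longrightarrow> t * paraboloid y R x \<le> u x\<rbrakk>
      \<Longrightarrow> \<forall>x\<in>cball y R. t * paraboloid y R x \<le> u x"
    using comparison by blast
  obtain \<alpha> A where A: "0 \<le> \<alpha>" "\<alpha> < 2 * s" "0 < A" "\<And>x. \<bar>u x\<bar> \<le> A * (1 + norm x) powr \<alpha>"
    using u_space_S by (auto simp: space_S_def)
  define K where "K = C s * CARD('n) / (s * (1 - s))"
  have K: "0 < K" using C_pos s by (simp add: K_def)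
  define c where "c = (1 - \<theta>\<^sup>2) powr s"
  have \<theta>2: "\<theta>\<^sup>2 < 1" using \<theta> by (simp add: power_less_one_iff)
  then have c: "0 < c" by (simp add: c_def)
  define M where "M = K * (A * 3 powr \<alpha>) powr (1 - p) / c"
  have growth: "R powr (2 * s - \<alpha> * (1 - p)) \<le> M" if R1: "1 \<le> R" for R
  proof -
    have R: "0 < R" using R1 by simp
    \<comment> \<open>Height \<open>R + 1\<close> keeps the closed ball inside the half space, while
      \<open>1 + norm y = R + 2 \<le> 3 * R\<close>.\<close>
    define y where "y = (R + 1) *\<^sub>R axis k (1::real)"
    have yk: "y $ k = R + 1" and ny: "norm y = R + 1" using R by (simp_all add: y_def norm_axis_1)
    have sub: "cball y R \<subseteq> half_space k" by (rule cball_subset_half_space) (simp add: yk)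
    have "\<theta> * R < R" using \<theta> R by simp
    then have sub\<theta>: "cball y (\<theta> * R) \<subseteq> ball y R" by auto
    then have sub\<theta>H: "cball y (\<theta> * R) \<subseteq> half_space k" using sub by (meson ball_subset_cball order_trans)
    have P_pos: "0 < paraboloid y R x" if "x \<in> cball y (\<theta> * R)" for x
      using that sub\<theta> R by (auto simp: paraboloid_gt_0_iff)
    have "lsc_on (cball y (\<theta> * R)) (\<lambda>x. (u x - 0) / paraboloid y R x)"
      by (intro lsc_on_diff_divide lsc_on_subset[OF u_lsc sub\<theta>H] continuous_on_paraboloid
          continuous_on_const P_pos)
    moreover have "cball y (\<theta> * R) \<noteq> {}" using mult_pos_pos[OF \<theta>(1) R] by (simp add: not_less)
    ultimately obtain x0 where x0: "x0 \<in> cball y (\<theta> * R)"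
      and min: "\<And>x. x \<in> cball y (\<theta> * R) \<Longrightarrow> u x0 / paraboloid y R x0 \<le> u x / paraboloid y R x"
      using lsc_on_attains_inf[OF _ compact_cball] by (metis (no_types, lifting) diff_zero)
    \<comment> \<open>As the minimal quotient, \<open>t\<close> is the largest factor keeping the
      barrier below \<open>u\<close> on the inner ball; contact occurs at \<open>x0\<close>.\<close>
    define t q where "t = u x0 / paraboloid y R x0" and "q = paraboloid y R x0"
    have q: "0 < q" using P_pos[OF x0] by (simp add: q_def)
    have w: "0 < u x0" using strong_minimum_principle[OF z] x0 sub\<theta>H by auto
    have t: "0 < t" using w q by (simp add: t_def q_def)
    have ux0: "u x0 = t * q" using q by (simp add: t_def q_def)
    have below: "\<forall>x\<in>cball y R. t * paraboloid y R x \<le> u x"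
    proof (rule comp[OF R t sub])
      fix x assume x: "x \<in> cball y (\<theta> * R)"
      have "t \<le> u x / paraboloid y R x" unfolding t_def by (rule min[OF x])
      then show "t * paraboloid y R x \<le> u x" using P_pos[OF x] by (simp add: pos_le_divide_eq)
    qed
    have "u x0 powr p \<le> C s * t * (CARD('n) * (paraboloid y R x0 powr (1 - s) / (s * (1 - s))))"
      using below x0 sub\<theta> sub ux0
      by (intro touching_powr_le[OF t R]) (auto simp: q_def subset_iff)
    also have "\<dots> = K * (t * q powr (1 - s))" by (simp add: K_def q_def)
    also have "\<dots> = K * u x0 * q powr (- s)"
      using powr_mult_base[of q "- s"] q by (simp add: ux0)
    finally have "u x0 powr p * q powr s \<le> K * u x0 * q powr (- s) * q powr s"
      by (intro mult_right_mono) auto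
    then have "u x0 powr p * q powr s \<le> K * u x0"
      using q by (simp add: mult.assoc powr_add[symmetric])
    \<comment> \<open>Splitting off \<open>u x0 powr p\<close> allows it to be cancelled, since
      \<open>u x0 > 0\<close> by the strong minimum principle.\<close>
    moreover have "u x0 = u x0 powr p * u x0 powr (1 - p)" using w by (simp add: powr_add[symmetric])
    ultimately have "u x0 powr p * q powr s \<le> u x0 powr p * (K * u x0 powr (1 - p))"
      by (metis mult.left_commute)
    then have q_le: "q powr s \<le> K * u x0 powr (1 - p)" using w by simp
    have "(norm (x0 - y))\<^sup>2 \<le> (\<theta> * R)\<^sup>2"
      using x0 by (intro power_mono) (auto simp: dist_norm norm_minus_commute)
    then have "(1 - \<theta>\<^sup>2) * R\<^sup>2 \<le> q" by (simp add: q_def paraboloid_def algebra_simps power_mult_distrib)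
    then have "((1 - \<theta>\<^sup>2) * R\<^sup>2) powr s \<le> q powr s" using \<theta>2 s by (intro powr_mono2) auto
    moreover have "((1 - \<theta>\<^sup>2) * R\<^sup>2) powr s = c * R powr (2 * s)"
      using \<theta>2 R powr_powr[of R 2 s] by (simp add: c_def powr_mult powr_numeral)
    ultimately have cR: "c * R powr (2 * s) \<le> K * u x0 powr (1 - p)" using q_le by linarith
    \<comment> \<open>The paraboloid peaks at \<open>y\<close>, so the contact value is at most
      \<open>u y\<close>, to which the growth condition applies.\<close>
    have "u x0 \<le> t * R\<^sup>2" unfolding ux0 using t by (simp add: q_def paraboloid_def)
    also have "\<dots> = t * paraboloid y R y" by (simp add: paraboloid_def)
    also have "\<dots> \<le> u y" using below R by simp
    also have "\<dots> \<le> A * (1 + norm y) powr \<alpha>" using A(4)[of y] by simp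
    also have "\<dots> \<le> A * (3 * R) powr \<alpha>" using A R1 by (intro mult_left_mono powr_mono2) (auto simp: ny)
    also have "\<dots> = A * 3 powr \<alpha> * R powr \<alpha>" using R by (simp add: powr_mult)
    finally have "u x0 powr (1 - p) \<le> (A * 3 powr \<alpha> * R powr \<alpha>) powr (1 - p)"
      using w p by (intro powr_mono2) auto
    also have "\<dots> = (A * 3 powr \<alpha>) powr (1 - p) * R powr (\<alpha> * (1 - p))"
      using A R by (simp add: powr_mult powr_powr)
    finally have "c * R powr (2 * s) \<le> K * ((A * 3 powr \<alpha>) powr (1 - p) * R powr (\<alpha> * (1 - p)))"
      using cR K by (meson mult_left_mono less_imp_le order_trans)
    then have "R powr (2 * s) \<le> M * R powr (\<alpha> * (1 - p))"
      using c by (simp add: M_def field_simps)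
    then show ?thesis using R by (simp add: powr_diff pos_divide_le_eq)
  qed
  define e where "e = 2 * s - \<alpha> * (1 - p)"
  have "\<alpha> * (1 - p) \<le> \<alpha> * 1" using A p by (intro mult_left_mono) auto
  then have e: "0 < e" using A by (simp add: e_def)
  have M: "1 \<le> M" using growth[of 1] by simp
  \<comment> \<open>This value, used as \<open>R\<close>, turns \<open>growth\<close> into
    \<open>M + 1 \<le> M\<close>.\<close>
  have "1 \<le> (M + 1) powr (1 / e)" using M e by (intro ge_one_powr_ge_zero) auto
  then have "((M + 1) powr (1 / e)) powr e \<le> M" using growth by (simp add: e_def)
  moreover have "((M + 1) powr (1 / e)) powr e = M + 1" using M e by (simp add: powr_powr)
  ultimately show False by simp
qed

end

theorem theorem1p4:
  fixes k :: "'n::finite" and C :: "real \<Rightarrow> real" and s p :: real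
    and u :: "real ^ 'n \<Rightarrow> real"
  assumes "2 \<le> CARD('n)"
    and "0 < s" and "s < 1"
    and "normalizing_constant TYPE('n) C"
    and "u \<in> space_S s (half_space k)" and "lsc_on (half_space k) u"
    and "\<forall>x. 0 \<le> u x"
    and "viscosity_supersolution_exterior s (half_space k) (I_minus C s) (\<lambda>x t. t powr p) u"
    and "0 < p" and "p \<le> 1"
  shows "\<forall>x\<in>half_space k. u x = 0"
proof -
  interpret half_space_supersolution k C s p u
    using assms by unfold_locales
      (auto simp: normalizing_constant_def viscosity_supersolution_exterior_def)
  show ?thesis using no_positive_point assms by (metis order_le_less)
qed

end
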